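(* There is a continuous function $Q:[{}^\omega2]^3_{E_0}\to{}^\omega2$ such that for every $E_0$-tree $p$, $Q[[[p]]^3_{E_0}]={}^\omega2$.
   Context: $E_0$ on ${}^\omega2$: $x\,E_0\,y$ iff $(\exists n)(\forall k>n)(x(k)=y(k))$. For $A\subseteq{}^\omega2$, $[A]^3_{E_0}=\{(x_0,x_1,x_2)\in{}^3A:(\forall i\neq j)\neg(x_i\,E_0\,x_j)\}$, with the subspace topology from ${}^3({}^\omega2)$. An $E_0$-tree is a tree $p\subseteq{}^{<\omega}2$ for which there are strings $s, v_n^i$ ($n\in\omega$, $i\in2$) with $\langle i\rangle\subseteq v_n^i$ and $|v_n^0|=|v_n^1|$ such that $p$ is the downward closure of $\{\varphi(\sigma):\sigma\in{}^{<\omega}2\}$, where $\varphi(\emptyset)=s$ and $\varphi(\sigma)=s^\frown v_0^{\sigma(0)}{}^\frown\cdots{}^\frown v_{|\sigma|-1}^{\sigma(|\sigma|-1)}$. $[p]$ is the set of infinite branches of $p$. *)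

theory Defs
  imports "HOL-Analysis.Analysis" "HOL-Library.Numeral_Type" "HOL-Library.Sublist"
begin

text \<open>
  The set \<open>2 = {0, 1}\<close> is rendered by \<^typ>\<open>bool\<close>, with \<open>0\<close> as \<^const>\<open>False\<close> and \<open>1\<close> as
  \<^const>\<open>True\<close>. Since \<^typ>\<open>bool\<close> carries the discrete topology and function types the product
  topology, \<open>nat \<Rightarrow> bool\<close> is Cantor space, and \<open>3 \<Rightarrow> nat \<Rightarrow> bool\<close> is its third power; the three
  elements of the index type \<^typ>\<open>3\<close> are \<open>0\<close>, \<open>1\<close> and \<open>2\<close>.
\<close>

type_synonym cantor = "nat \<Rightarrow> bool"

definition E0 :: "cantor \<Rightarrow> cantor \<Rightarrow> bool" where
  "E0 x y \<longleftrightarrow> (\<exists>n. \<forall>k>n. x k = y k)"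

definition E0_triples :: "cantor set \<Rightarrow> (3 \<Rightarrow> cantor) set" where
  "E0_triples A = {x. (\<forall>i. x i \<in> A) \<and> (\<forall>i j. i \<noteq> j \<longrightarrow> \<not> E0 (x i) (x j))}"

definition tree :: "bool list set \<Rightarrow> bool" where
  "tree p \<longleftrightarrow> (\<forall>t\<in>p. \<forall>u. prefix u t \<longrightarrow> u \<in> p)"

definition branches :: "bool list set \<Rightarrow> cantor set" where
  "branches p = {x. \<forall>n. map x [0..<n] \<in> p}"

text \<open>\<open>v n i\<close> is the string \<open>v\<^sub>n\<^sup>i\<close>.\<close>

definition E0_embed :: "bool list \<Rightarrow> (nat \<Rightarrow> bool \<Rightarrow> bool list) \<Rightarrow> bool list \<Rightarrow> bool list" where
  "E0_embed s v \<sigma> = s @ concat (map (\<lambda>n. v n (\<sigma> ! n)) [0..<length \<sigma>])"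

definition E0_tree :: "bool list set \<Rightarrow> bool" where
  "E0_tree p \<longleftrightarrow> tree p \<and>
    (\<exists>s v. (\<forall>n i. prefix [i] (v n i)) \<and>
           (\<forall>n. length (v n False) = length (v n True)) \<and>
           p = {u. \<exists>\<sigma>. prefix u (E0_embed s v \<sigma>)})"

end

(*
  Wherever the three reals do not all agree, exactly one of them is the odd one out, because there
  are only two possible values.  Let o_0, o_1, ... be the sequence of odd ones out with consecutive
  repetitions removed; it is infinite, since otherwise two of the reals would be E0-equivalent.
  Q reads a bit from each difference o_(k+1) - o_k, which is 1 or 2 modulo 3.  Along an E0-tree a
  whole block v_n^0, v_n^1 contributes just one odd one out, however often the two strings differ,
  so every sequence o with o_(k+1) different from o_k is realised by branches of the tree.
*)
theory Submission
  imports Defs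
begin

section \<open>The odd one out among three bits\<close>

lemma cases_3:
  fixes i :: 3
  obtains "i = 0" | "i = 1" | "i = 2"
  using exhaust_3[of i] by auto

definition odd_one :: "(3 \<Rightarrow> bool) \<Rightarrow> 3 option" where
  "odd_one a = (if a 0 = a 1 \<and> a 1 = a 2 then None
    else if a 1 = a 2 then Some 0 else if a 0 = a 2 then Some 1 else Some 2)"

lemma odd_one_None: "odd_one a = None \<Longrightarrow> a i = a j"
  by (cases i rule: cases_3; cases j rule: cases_3) (auto simp: odd_one_def split: if_splits)

lemma odd_one_Some: "odd_one a = Some c \<Longrightarrow> i \<noteq> c \<Longrightarrow> j \<noteq> c \<Longrightarrow> a i = a j"
  by (cases i rule: cases_3; cases j rule: cases_3) (auto simp: odd_one_def split: if_splits)

text \<open>The shape met along a tree: index \<open>c\<close> takes one value and the two other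
  indices share the other.\<close>

lemma odd_one_eq: "odd_one (\<lambda>i. f (i = c)) = (if f True = f False then None else Some c)"
  by (cases c rule: cases_3) (auto simp: odd_one_def)

section \<open>Finite histories of odd ones out\<close>

fun push :: "'a list \<Rightarrow> 'a option \<Rightarrow> 'a list" where
  "push h None = h"
| "push h (Some i) = (if h \<noteq> [] \<and> last h = i then h else h @ [i])"

lemma prefix_push: "prefix h (push h c)"
  by (cases c) auto

lemma foldl_push_absorb:
  assumes "\<And>c. c \<in> set cs \<Longrightarrow> c = None \<or> c = Some a"
  shows "foldl push (h @ [a]) cs = h @ [a]"
  using assms
proof (induction cs)
  case (Cons c cs)
  then have "push (h @ [a]) c = h @ [a]"
    by (metis list.set_intros(1) push.simps snoc_eq_iff_butlast)
  with Cons show ?case by simp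
qed simp

text \<open>The part of the sequence of odd ones out that is visible in the first \<open>n\<close>
  columns. It depends on finitely many bits and only grows with \<open>n\<close>.\<close>

definition hist :: "(3 \<Rightarrow> cantor) \<Rightarrow> nat \<Rightarrow> 3 list" where
  "hist x n = foldl push [] (map (\<lambda>k. odd_one (\<lambda>i. x i k)) [0..<n])"

lemma hist_0 [simp]: "hist x 0 = []"
  by (simp add: hist_def)

lemma hist_Suc: "hist x (Suc n) = push (hist x n) (odd_one (\<lambda>i. x i n))"
  by (simp add: hist_def)

lemma hist_add:
  "hist x (n + m) = foldl push (hist x n) (map (\<lambda>k. odd_one (\<lambda>i. x i k)) [n..<n + m])"
  by (simp add: hist_def upt_add_eq_append[of 0 n])

lemma prefix_hist: "n \<le> m \<Longrightarrow> prefix (hist x n) (hist x m)"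
proof (induction rule: dec_induct)
  case (step m)
  show ?case unfolding hist_Suc by (rule prefix_order.trans[OF step.IH prefix_push])
qed simp

lemma hist_cong: "(\<And>i k. k < n \<Longrightarrow> x i k = y i k) \<Longrightarrow> hist x n = hist y n"
  by (induction n) (auto simp: hist_Suc)

lemma prefix_nth: "prefix xs ys \<Longrightarrow> k < length xs \<Longrightarrow> ys ! k = xs ! k"
  by (auto simp: prefix_def nth_append)

lemma hist_nth_eq:
  assumes "k < length (hist x n)" "k < length (hist x m)"
  shows "hist x n ! k = hist x m ! k"
proof -
  have "prefix (hist x n) (hist x m) \<or> prefix (hist x m) (hist x n)"
    by (meson nat_le_linear prefix_hist)
  with assms show ?thesis by (metis prefix_nth)
qed

text \<open>A bounded history stabilises at some \<open>N\<close>. From then on only its last entry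
  can be the odd one out, so the two other reals agree and are E0-equivalent.\<close>

lemma hist_unbounded:
  assumes "x \<in> E0_triples A"
  shows "\<exists>n. k < length (hist x n)"
proof (rule ccontr)
  assume "\<not> ?thesis"
  then have "\<forall>n. length (hist x n) \<le> k" by (simp add: not_less)
  then obtain N where N: "\<And>n. length (hist x n) \<le> length (hist x N)"
    using ex_has_greatest_nat[of "\<lambda>_. True" 0 "\<lambda>n. length (hist x n)" "Suc k"]
    by (auto simp: less_Suc_eq_le)
  have stable: "hist x n = hist x N" if "n \<ge> N" for n
    using prefix_hist[OF that, of x] N[of n] by (auto simp: prefix_def)
  have absorb: "push (hist x N) (odd_one (\<lambda>i. x i n)) = hist x N" if "n \<ge> N" for n
    using stable[of n] stable[of "Suc n"] that by (simp add: hist_Suc)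
  \<comment> \<open>If the history is empty, \<open>last\<close> is unspecified, but then every
    column from \<open>N\<close> on gives \<open>None\<close>, so the claim still holds.\<close>
  have col: "odd_one (\<lambda>i. x i n) \<in> {None, Some (last (hist x N))}" if "n \<ge> N" for n
    using absorb[OF that] by (cases "odd_one (\<lambda>i. x i n)") (auto split: if_splits)
  define c where "c = last (hist x N)"
  \<comment> \<open>Arithmetic in the index type is modulo 3, so \<open>c + 1\<close> and
    \<open>c + 2\<close> are the two indices other than \<open>c\<close>.\<close>
  have "x (c + 1) n = x (c + 2) n" if "n \<ge> N" for n
  proof -
    have "c + 1 \<noteq> c" "c + 2 \<noteq> c" by simp_all
    with col[OF that] show ?thesis
      using odd_one_None[of "\<lambda>i. x i n"] odd_one_Some[of "\<lambda>i. x i n" c]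
      unfolding c_def by blast
  qed
  then have "E0 (x (c + 1)) (x (c + 2))" unfolding E0_def by (meson less_imp_le)
  moreover have "c + 1 \<noteq> c + 2" by simp
  ultimately show False using assms by (auto simp: E0_triples_def)
qed

section \<open>The map and its continuity\<close>

definition Q_map :: "(3 \<Rightarrow> cantor) \<Rightarrow> cantor" where
  "Q_map x k = (let h = hist x (LEAST n. Suc k < length (hist x n)) in h ! Suc k = h ! k + 1)"

text \<open>Histories are nested prefixes, so every sufficiently late stage gives the same bit as
  the least one.\<close>

lemma Q_map_eq:
  assumes "Suc k < length (hist x n)"
  shows "Q_map x k \<longleftrightarrow> hist x n ! Suc k = hist x n ! k + 1"
proof -
  define m where "m = (LEAST n. Suc k < length (hist x n))"
  have "Suc k < length (hist x m)" unfolding m_def using assms by (rule LeastI)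
  with assms have "hist x n ! Suc k = hist x m ! Suc k" "hist x n ! k = hist x m ! k"
    by (auto intro: hist_nth_eq)
  then show ?thesis by (simp add: Q_map_def m_def Let_def)
qed

text \<open>Each output bit is read off a finite history, hence off finitely many input bits, and so
  is locally constant.\<close>

lemma continuous_on_Q_map: "continuous_on (E0_triples A) Q_map"
proof (rule continuous_on_coordinatewise_then_product)
  fix k
  show "continuous_on (E0_triples A) (\<lambda>x. Q_map x k)"
    unfolding continuous_on_def
  proof
    fix x assume "x \<in> E0_triples A"
    then obtain n where n: "Suc k < length (hist x n)" using hist_unbounded by blast
    let ?F = "at x within E0_triples A"
    \<comment> \<open>As \<open>bool\<close> is discrete, convergence of a coordinate means eventual
      equality.\<close>
    have "\<forall>\<^sub>F y in ?F. y i m = x i m" for i m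
    proof -
      have "continuous_on UNIV (\<lambda>y :: 3 \<Rightarrow> cantor. y i m)"
        by (rule continuous_on_product_then_coordinatewise) (rule continuous_on_product_coordinates)
      then have "((\<lambda>y. y i m) \<longlongrightarrow> x i m) (at x)"
        by (simp add: continuous_on_def)
      then have "((\<lambda>y. y i m) \<longlongrightarrow> x i m) ?F"
        by (rule tendsto_within_subset) simp
      then show ?thesis by (simp add: tendsto_discrete)
    qed
    then have "\<forall>\<^sub>F y in ?F. \<forall>i. \<forall>m\<in>{..<n}. y i m = x i m"
      by (intro eventually_all_finite eventually_ball_finite ballI) auto
    then have "\<forall>\<^sub>F y in ?F. Q_map y k = Q_map x k"
    proof eventually_elim
      case (elim y)
      then have "hist y n = hist x n" by (intro hist_cong) auto
      with n show ?case by (simp add: Q_map_eq[where n = n])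
    qed
    then show "((\<lambda>x. Q_map x k) \<longlongrightarrow> Q_map x k) ?F" by (rule tendsto_eventually)
  qed
qed

section \<open>Branches of an E0-tree\<close>

locale E0_strings =
  fixes s :: "bool list" and v :: "nat \<Rightarrow> bool \<Rightarrow> bool list"
  assumes prefix_v: "prefix [i] (v n i)"
    and length_v: "length (v n False) = length (v n True)"
begin

text \<open>The position where block \<open>n\<close> begins on every branch; it is common to all of
  them because \<open>v n False\<close> and \<open>v n True\<close> have equal length.\<close>

definition block_start :: "nat \<Rightarrow> nat" where
  "block_start n = length s + (\<Sum>m<n. length (v m True))"

text \<open>Blocks are nonempty, so \<open>Suc k\<close> of them always reach past position
  \<open>k\<close>.\<close>

definition branch :: "cantor \<Rightarrow> cantor" where
  "branch z k = E0_embed s v (map z [0..<Suc k]) ! k"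

lemma length_v_eq: "length (v n i) = length (v n True)"
  using length_v by (cases i) auto

lemma v_nonempty: "0 < length (v n i)"
  using prefix_v[of i n] by (auto simp: prefix_def)

lemma v_nth_0: "v n i ! 0 = i"
  using prefix_v[of i n] by (auto simp: prefix_def)

lemma block_start_Suc: "block_start (Suc n) = block_start n + length (v n True)"
  by (simp add: block_start_def)

lemma block_start_ge: "n \<le> block_start n"
proof (induction n)
  case (Suc n)
  then show ?case using v_nonempty[of n True] by (simp add: block_start_Suc del: length_greater_0_conv)
qed simp

lemma embed_map: "E0_embed s v (map z [0..<n]) = s @ concat (map (\<lambda>m. v m (z m)) [0..<n])"
proof -
  have "map (\<lambda>m. v m (map z [0..<n] ! m)) [0..<n] = map (\<lambda>m. v m (z m)) [0..<n]"
    by (rule map_cong) auto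
  then show ?thesis by (simp only: E0_embed_def length_map length_upt diff_zero)
qed

lemma embed_Suc: "E0_embed s v (map z [0..<Suc n]) = E0_embed s v (map z [0..<n]) @ v n (z n)"
  unfolding embed_map by simp

lemma length_embed: "length (E0_embed s v (map z [0..<n])) = block_start n"
proof (induction n)
  case 0
  then show ?case by (simp add: E0_embed_def block_start_def)
next
  case (Suc n)
  then show ?case by (simp only: embed_Suc length_append block_start_Suc length_v_eq[of n "z n"])
qed

lemma prefix_embed:
  "n \<le> m \<Longrightarrow> prefix (E0_embed s v (map z [0..<n])) (E0_embed s v (map z [0..<m]))"
proof (induction rule: dec_induct)
  case (step m)
  show ?case unfolding embed_Suc by (rule prefix_prefix) (rule step.IH)
qed simp

lemma branch_nth:
  assumes "k < block_start n"
  shows "branch z k = E0_embed s v (map z [0..<n]) ! k"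
proof -
  let ?e = "\<lambda>n. E0_embed s v (map z [0..<n])"
  have "prefix (?e n) (?e (Suc k)) \<or> prefix (?e (Suc k)) (?e n)"
    by (meson nat_le_linear prefix_embed)
  moreover have "k < length (?e n)" "k < length (?e (Suc k))"
    using assms block_start_ge[of "Suc k"] by (auto simp only: length_embed)
  ultimately show ?thesis
    unfolding branch_def using prefix_nth[of "?e n" "?e (Suc k)" k] prefix_nth[of "?e (Suc k)" "?e n" k]
    by argo
qed

lemma branch_root: "k < length s \<Longrightarrow> branch z k = s ! k"
  by (subst branch_nth[of _ 0]) (auto simp: block_start_def E0_embed_def)

lemma branch_block:
  assumes "j < length (v n True)"
  shows "branch z (block_start n + j) = v n (z n) ! j"
  using assms branch_nth[of "block_start n + j" "Suc n" z]
  by (simp only: block_start_Suc embed_Suc nth_append length_embed) simp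

lemma branch_in_branches:
  "branch z \<in> branches {u. \<exists>\<sigma>. prefix u (E0_embed s v \<sigma>)}"
proof -
  have "map (branch z) [0..<n] = take n (E0_embed s v (map z [0..<n]))" for n
  proof (rule nth_equalityI)
    fix k assume "k < length (map (branch z) [0..<n])"
    then show "map (branch z) [0..<n] ! k = take n (E0_embed s v (map z [0..<n])) ! k"
      using block_start_ge[of n] by (simp add: branch_nth[of _ n])
  qed (use block_start_ge[of n] in \<open>simp add: length_embed\<close>)
  then have "\<exists>\<sigma>. prefix (map (branch z) [0..<n]) (E0_embed s v \<sigma>)" for n
    by (metis take_is_prefix)
  then show ?thesis unfolding branches_def by blast
qed

section \<open>Realising a prescribed history\<close>

text \<open>In block \<open>n\<close> the real with index \<open>c n\<close> follows
  \<open>v n True\<close> and the two others follow \<open>v n False\<close>. These differ at their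
  first bit, so \<open>c n\<close> is recorded there; later differences in the block only repeat
  it.\<close>

lemma hist_branches:
  assumes "\<And>n. c (Suc n) \<noteq> c n"
  shows "hist (\<lambda>i. branch (\<lambda>n. i = c n)) (block_start n) = map c [0..<n]"
    (is "hist ?x _ = _")
proof (induction n)
  case 0
  have "hist ?x k = []" if "k \<le> length s" for k
    using that by (induction k) (auto simp: hist_Suc branch_root odd_one_def)
  then show ?case by (simp add: block_start_def)
next
  case (Suc n)
  let ?o = "\<lambda>k. odd_one (\<lambda>i. ?x i k)"
  define b l where "b = block_start n" and "l = length (v n True)"
  have o: "?o (b + j) = (if v n True ! j = v n False ! j then None else Some (c n))" if "j < l" for j
    using that odd_one_eq[of "\<lambda>t. v n t ! j" "c n"] by (simp add: branch_block b_def l_def)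
  have "0 < l" using v_nonempty by (simp add: l_def)
  then have upt: "[b..<b + l] = b # [Suc b..<b + l]" by (simp add: upt_rec)
  have "?o b = Some (c n)" using o[of 0] \<open>0 < l\<close> by (simp add: v_nth_0)
  \<comment> \<open>For \<open>n = 0\<close> the history is empty, so there is no last entry that
    could absorb \<open>c 0\<close>.\<close>
  moreover have "n \<noteq> 0 \<Longrightarrow> last (map c [0..<n]) \<noteq> c n"
    using assms[of "n - 1"] by (auto simp: last_map)
  ultimately have first: "push (map c [0..<n]) (?o b) = map c [0..<n] @ [c n]" by auto
  have rest: "a = None \<or> a = Some (c n)" if a: "a \<in> set (map ?o [Suc b..<b + l])" for a
  proof -
    obtain k where "a = ?o k" "Suc b \<le> k" "k < b + l" using a by auto
    then show ?thesis using o[of "k - b"] by (auto split: if_splits)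
  qed
  have "hist ?x (block_start (Suc n)) = foldl push (map c [0..<n]) (map ?o [b..<b + l])"
    using hist_add[of ?x b l] Suc.IH by (simp add: block_start_Suc b_def l_def)
  also have "\<dots> = foldl push (map c [0..<n] @ [c n]) (map ?o [Suc b..<b + l])"
    by (simp only: upt list.map foldl_Cons first)
  also have "\<dots> = map c [0..<n] @ [c n]" by (rule foldl_push_absorb) (rule rest)
  finally show ?case by simp
qed

text \<open>If the branches of \<open>i\<close> and \<open>j\<close> eventually agree, compare them
  at the starts of late blocks: neither index is \<open>c n\<close>, so \<open>c n\<close> is always
  the third index, although \<open>c\<close> never repeats.\<close>

lemma branches_in_E0_triples:
  assumes "\<And>n. c (Suc n) \<noteq> c n"
  shows "(\<lambda>i. branch (\<lambda>n. i = c n)) \<in> E0_triples (branches {u. \<exists>\<sigma>. prefix u (E0_embed s v \<sigma>)})"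
proof -
  have "\<not> E0 (branch (\<lambda>n. i = c n)) (branch (\<lambda>n. j = c n))" if "i \<noteq> j" for i j :: 3
  proof
    assume "E0 (branch (\<lambda>n. i = c n)) (branch (\<lambda>n. j = c n))"
    then obtain N where N: "\<And>k. k > N \<Longrightarrow> branch (\<lambda>n. i = c n) k = branch (\<lambda>n. j = c n) k"
      unfolding E0_def by blast
    have "(i = c n) = (j = c n)" if "n > N" for n
      using N[of "block_start n"] block_start_ge[of n] that v_nonempty[of n]
        branch_block[of 0 n "\<lambda>n. i = c n"] branch_block[of 0 n "\<lambda>n. j = c n"]
      by (simp add: v_nth_0)
    from this[of "Suc N"] this[of "Suc (Suc N)"] have
      "c (Suc N) \<noteq> i" "c (Suc N) \<noteq> j" "c (Suc (Suc N)) \<noteq> i" "c (Suc (Suc N)) \<noteq> j"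
      using \<open>i \<noteq> j\<close> by auto
    with \<open>i \<noteq> j\<close> assms[of "Suc N"] show False
      by (cases i rule: cases_3; cases j rule: cases_3; cases "c (Suc N)" rule: cases_3;
          cases "c (Suc (Suc N))" rule: cases_3) auto
  qed
  then show ?thesis by (simp add: E0_triples_def branch_in_branches)
qed

text \<open>Any \<open>y\<close> is the difference pattern of a suitable sequence \<open>c\<close>,
  and the tree realises that sequence as a history.\<close>

lemma Q_map_surj:
  "y \<in> Q_map ` E0_triples (branches {u. \<exists>\<sigma>. prefix u (E0_embed s v \<sigma>)})"
proof -
  \<comment> \<open>A step of 1 encodes \<open>True\<close> and a step of 2 encodes
    \<open>False\<close>; neither is 0 modulo 3, so consecutive values differ.\<close>
  define c :: "nat \<Rightarrow> 3" where "c = rec_nat 0 (\<lambda>n a. if y n then a + 1 else a + 2)"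
  have c_Suc: "c (Suc n) = (if y n then c n + 1 else c n + 2)" for n
    by (simp add: c_def)
  then have c: "c (Suc n) \<noteq> c n" for n by simp
  let ?x = "\<lambda>i. branch (\<lambda>n. i = c n)"
  have "Q_map ?x k = y k" for k
  proof -
    have "Q_map ?x k \<longleftrightarrow> c (Suc k) = c k + 1"
      \<comment> \<open>After \<open>k + 2\<close> blocks the history has length
        \<open>k + 2\<close>, just enough for the entries \<open>k\<close> and
        \<open>Suc k\<close>.\<close>
      by (subst Q_map_eq[where n = "block_start (Suc (Suc k))"])
        (simp_all add: hist_branches[of c, OF c] nth_append del: upt_Suc)
    then show ?thesis by (simp add: c_Suc)
  qed
  then have "y = Q_map ?x" by auto
  then show ?thesis using branches_in_E0_triples[of c, OF c] by (rule image_eqI)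
qed

end

theorem theorem9p2:
  shows "\<exists>Q :: (3 \<Rightarrow> cantor) \<Rightarrow> cantor.
           continuous_on (E0_triples UNIV) Q \<and>
           (\<forall>p. E0_tree p \<longrightarrow> Q ` E0_triples (branches p) = UNIV)"
proof (intro exI conjI allI impI)
  show "continuous_on (E0_triples UNIV) Q_map" by (rule continuous_on_Q_map)
  fix p assume "E0_tree p"
  then obtain s v where "E0_strings v" and "p = {u. \<exists>\<sigma>. prefix u (E0_embed s v \<sigma>)}"
    unfolding E0_tree_def E0_strings_def by blast
  then show "Q_map ` E0_triples (branches p) = UNIV"
    using E0_strings.Q_map_surj by blast
qed

end
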